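(* Let $\nu,d\in\mathbb{C}$ with $|\nu|\le 1$, let $\Phi(z)=\nu z+d$, and let $\Upsilon$ be an entire function on $\mathbb{C}$ such that the weighted composition operator $C_{\Upsilon,\Phi}$ is bounded on $H_E(\zeta)$. If $C_{\Upsilon,\Phi}$ is self-adjoint, then $$\Upsilon(z)=\alpha K_{\Phi(0)}(z)\quad\text{for all } z\in\mathbb{C},\quad\text{where }\alpha=\zeta_0^2\,\overline{\Upsilon(0)}\text{ is a real number},$$ and, according to the value of $\Upsilon(0)$, the corresponding one of the following is true: (i) if $\Upsilon(0)=0$, then $\Upsilon\equiv 0$, and consequently $C_{\Upsilon,\Phi}\equiv 0$; (ii) if $\Upsilon(0)\ne 0$, then $\nu$ is a real number.
   Context: Let $\mathbb{N}_0=\mathbb{N}\cup\{0\}$ and let $\zeta=(\zeta_n)_{n\in\mathbb{N}_0}$ be a sequence of positive real numbers with $\lim_{n\to\infty}\zeta_n^{1/n}=\infty$. The weighted Hardy space of entire functions induced by $\zeta$ is the Hilbert space $H_E(\zeta)=\{g(z)=\sum_{n=0}^\infty b_nz^n : \|g\|^2=\sum_{n=0}^\infty |b_n|^2\zeta_n^2<\infty\}$ of entire functions on $\mathbb{C}$, with inner product $\langle g,h\rangle=\sum_{n=0}^\infty b_n\overline{c_n}\zeta_n^2$ for $g(z)=\sum b_nz^n$ and $h(z)=\sum c_nz^n$ in $H_E(\zeta)$. For $p\in\mathbb{C}$, the reproducing kernel is $K_p(w)=\sum_{n=0}^\infty \frac{1}{\zeta_n^2}\overline{p}^{\,n}w^n$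 for $w\in\mathbb{C}$, which satisfies $f(p)=\langle f,K_p\rangle$ for all $f\in H_E(\zeta)$. For entire functions $\Upsilon,\Phi:\mathbb{C}\to\mathbb{C}$, the weighted composition operator is $C_{\Upsilon,\Phi}f=\Upsilon\cdot(f\circ\Phi)$; it is bounded on $H_E(\zeta)$ if it maps $H_E(\zeta)$ into itself as a bounded linear operator. *)

theory Defs
  imports "HOL-Complex_Analysis.Complex_Analysis"
begin

text \<open>The \<open>n\<close>-th coefficient \<open>b\<^sub>n\<close> of the expansion of an entire function about the origin.\<close>

definition taylor_coeff :: "(complex \<Rightarrow> complex) \<Rightarrow> nat \<Rightarrow> complex" where
  "taylor_coeff g n = (deriv ^^ n) g 0 / fact n"

definition HE :: "(nat \<Rightarrow> real) \<Rightarrow> (complex \<Rightarrow> complex) set" where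
  "HE \<zeta> = {g. g holomorphic_on UNIV \<and>
               summable (\<lambda>n. (cmod (taylor_coeff g n))\<^sup>2 * (\<zeta> n)\<^sup>2)}"

text \<open>For \<open>g\<close> and \<open>h\<close> in \<open>HE \<zeta>\<close> this series converges absolutely by
  Cauchy-Schwarz; the value for other arguments is irrelevant.\<close>

definition HE_inner ::
  "(nat \<Rightarrow> real) \<Rightarrow> (complex \<Rightarrow> complex) \<Rightarrow> (complex \<Rightarrow> complex) \<Rightarrow> complex" where
  "HE_inner \<zeta> g h =
     (\<Sum>n. taylor_coeff g n * cnj (taylor_coeff h n) * (complex_of_real (\<zeta> n))\<^sup>2)"

definition HE_norm :: "(nat \<Rightarrow> real) \<Rightarrow> (complex \<Rightarrow> complex) \<Rightarrow> real" where
  "HE_norm \<zeta> g = sqrt (\<Sum>n. (cmod (taylor_coeff g n))\<^sup>2 * (\<zeta> n)\<^sup>2)"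

definition HE_kernel :: "(nat \<Rightarrow> real) \<Rightarrow> complex \<Rightarrow> complex \<Rightarrow> complex" where
  "HE_kernel \<zeta> p w = (\<Sum>n. 1 / (complex_of_real (\<zeta> n))\<^sup>2 * cnj p ^ n * w ^ n)"

definition weighted_comp ::
  "(complex \<Rightarrow> complex) \<Rightarrow> (complex \<Rightarrow> complex) \<Rightarrow> (complex \<Rightarrow> complex) \<Rightarrow> complex \<Rightarrow> complex" where
  "weighted_comp \<Upsilon> \<Phi> f = (\<lambda>z. \<Upsilon> z * f (\<Phi> z))"

text \<open>Operators on \<open>HE \<zeta>\<close> are maps on all functions, of which only the restriction
  to \<open>HE \<zeta>\<close> matters.\<close>

definition HE_bounded_op ::
  "(nat \<Rightarrow> real) \<Rightarrow> ((complex \<Rightarrow> complex) \<Rightarrow> (complex \<Rightarrow> complex)) \<Rightarrow> bool" where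
  "HE_bounded_op \<zeta> T \<longleftrightarrow>
     (\<forall>f\<in>HE \<zeta>. T f \<in> HE \<zeta>) \<and>
     (\<forall>f\<in>HE \<zeta>. \<forall>g\<in>HE \<zeta>. T (\<lambda>z. f z + g z) = (\<lambda>z. T f z + T g z)) \<and>
     (\<forall>c. \<forall>f\<in>HE \<zeta>. T (\<lambda>z. c * f z) = (\<lambda>z. c * T f z)) \<and>
     (\<exists>M. \<forall>f\<in>HE \<zeta>. HE_norm \<zeta> (T f) \<le> M * HE_norm \<zeta> f)"

text \<open>\<open>S\<close> is the Hilbert space adjoint of the bounded operator \<open>T\<close>; as an operator on
  \<open>HE \<zeta>\<close> it is determined uniquely.\<close>

definition HE_is_adjoint ::
  "(nat \<Rightarrow> real) \<Rightarrow> ((complex \<Rightarrow> complex) \<Rightarrow> (complex \<Rightarrow> complex)) \<Rightarrow>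
     ((complex \<Rightarrow> complex) \<Rightarrow> (complex \<Rightarrow> complex)) \<Rightarrow> bool" where
  "HE_is_adjoint \<zeta> T S \<longleftrightarrow>
     HE_bounded_op \<zeta> T \<and> HE_bounded_op \<zeta> S \<and>
     (\<forall>f\<in>HE \<zeta>. \<forall>g\<in>HE \<zeta>. HE_inner \<zeta> (T f) g = HE_inner \<zeta> f (S g))"

definition HE_self_adjoint ::
  "(nat \<Rightarrow> real) \<Rightarrow> ((complex \<Rightarrow> complex) \<Rightarrow> (complex \<Rightarrow> complex)) \<Rightarrow> bool" where
  "HE_self_adjoint \<zeta> T \<longleftrightarrow> HE_is_adjoint \<zeta> T T"

end

(*
  Test self-adjointness on monomials only. From <T z^n, 1> = <z^n, T 1> and T 1 = Upsilon one reads
  off zeta_0^2 Upsilon(0) d^n = zeta_n^2 * cnj u_n, where u_n is the n-th Taylor coefficient of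
  Upsilon: this is the kernel formula, and n = 0 shows that Upsilon(0) is real. Next, <T z, z> is
  real, so the coefficient Upsilon(0) nu + u_1 d of z in T z is real; as u_1 d is a real multiple
  of d * cnj d, so is Upsilon(0) nu.
*)

theory Submission
  imports Defs
begin

lemma taylor_coeff_power:
  "taylor_coeff (\<lambda>z. z ^ k) n = (if n = k then 1 else 0)"
proof -
  have "(deriv ^^ n) (\<lambda>w::complex. (w - 0) ^ k) 0 = pochhammer (of_nat (Suc k - n)) n * (0 - 0) ^ (k - n)"
    by (rule higher_deriv_power)
  then have eq: "(deriv ^^ n) (\<lambda>w::complex. w ^ k) 0 = pochhammer (of_nat (Suc k - n)) n * 0 ^ (k - n)"
    by simp
  consider "n < k" | "n = k" | "k < n" by linarith
  then show ?thesis
  proof cases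
    case 1
    then show ?thesis using eq by (simp add: taylor_coeff_def)
  next
    case 2
    then show ?thesis using eq by (simp add: taylor_coeff_def pochhammer_fact [symmetric])
  next
    \<comment> \<open>Here \<open>0 ^ (k - n)\<close> is \<open>0 ^ 0 = 1\<close>, so the vanishing
      comes from the other factor: \<open>Suc k - n\<close> truncates to 0, and
      \<open>pochhammer 0 n\<close> is 0 for positive \<open>n\<close>.\<close>
    case 3
    then show ?thesis using eq by (simp add: taylor_coeff_def pochhammer_0_left)
  qed
qed

lemma taylor_coeff_sums:
  assumes "g holomorphic_on UNIV"
  shows "(\<lambda>n. taylor_coeff g n * z ^ n) sums g z"
proof -
  \<comment> \<open>The radius is chosen so that \<open>z\<close> lies inside the disc.\<close>
  have "g holomorphic_on ball 0 (cmod z + 1)"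
    using assms by (rule holomorphic_on_subset) simp
  from holomorphic_power_series [OF this, of z] show ?thesis
    by (simp add: taylor_coeff_def)
qed

lemma power_in_HE: "(\<lambda>z. z ^ k) \<in> HE \<zeta>"
proof -
  have "summable (\<lambda>n. (cmod (taylor_coeff (\<lambda>z. z ^ k) n))\<^sup>2 * (\<zeta> n)\<^sup>2)"
    by (rule summable_finite [of "{k}"]) (auto simp: taylor_coeff_power)
  then show ?thesis
    by (auto simp: HE_def intro!: holomorphic_intros)
qed

text \<open>Only the term with index \<open>k\<close> survives, so the series is a finite sum for
  every \<open>g\<close>.\<close>

lemma HE_inner_power_right:
  "HE_inner \<zeta> g (\<lambda>z. z ^ k) = taylor_coeff g k * (of_real (\<zeta> k))\<^sup>2"
  unfolding HE_inner_def by (subst suminf_finite [of "{k}"]) (auto simp: taylor_coeff_power)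

lemma HE_inner_power_left:
  "HE_inner \<zeta> (\<lambda>z. z ^ k) g = cnj (taylor_coeff g k) * (of_real (\<zeta> k))\<^sup>2"
  unfolding HE_inner_def by (subst suminf_finite [of "{k}"]) (auto simp: taylor_coeff_power)

text \<open>The monomials are orthogonal with squared norms \<open>(\<zeta> n)\<^sup>2\<close>. In
  this basis self-adjointness says that the matrix of \<open>T\<close>, weighted by these norms, is
  Hermitian.\<close>

lemma self_adjoint_power_coeff:
  assumes "HE_self_adjoint \<zeta> T"
  shows "taylor_coeff (T (\<lambda>z. z ^ m)) n * (of_real (\<zeta> n))\<^sup>2
       = cnj (taylor_coeff (T (\<lambda>z. z ^ n)) m) * (of_real (\<zeta> m))\<^sup>2"
proof -
  have "HE_inner \<zeta> (T (\<lambda>z. z ^ m)) (\<lambda>z. z ^ n) = HE_inner \<zeta> (\<lambda>z. z ^ m) (T (\<lambda>z. z ^ n))"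
    using assms power_in_HE by (auto simp: HE_self_adjoint_def HE_is_adjoint_def)
  then show ?thesis
    by (simp add: HE_inner_power_right HE_inner_power_left)
qed

theorem theorem2p7:
  fixes \<zeta> :: "nat \<Rightarrow> real" and \<nu> d :: complex and \<Phi> \<Upsilon> :: "complex \<Rightarrow> complex"
  assumes "\<And>n. \<zeta> n > 0"
    and "filterlim (\<lambda>n. root n (\<zeta> n)) at_top sequentially"
    and "cmod \<nu> \<le> 1"
    and "\<And>z. \<Phi> z = \<nu> * z + d"
    and "\<Upsilon> holomorphic_on UNIV"
    and "HE_bounded_op \<zeta> (weighted_comp \<Upsilon> \<Phi>)"
    and "HE_self_adjoint \<zeta> (weighted_comp \<Upsilon> \<Phi>)"
  shows "(let \<alpha> = (complex_of_real (\<zeta> 0))\<^sup>2 * cnj (\<Upsilon> 0)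
          in \<alpha> \<in> \<real> \<and> (\<forall>z. \<Upsilon> z = \<alpha> * HE_kernel \<zeta> (\<Phi> 0) z)) \<and>
         (\<Upsilon> 0 = 0 \<longrightarrow>
            (\<forall>z. \<Upsilon> z = 0) \<and> (\<forall>f\<in>HE \<zeta>. \<forall>z. weighted_comp \<Upsilon> \<Phi> f z = 0)) \<and>
         (\<Upsilon> 0 \<noteq> 0 \<longrightarrow> \<nu> \<in> \<real>)"
proof -
  define T where "T = weighted_comp \<Upsilon> \<Phi>"
  have sa: "HE_self_adjoint \<zeta> T"
    using assms(7) by (simp add: T_def)
  have \<zeta>0: "complex_of_real (\<zeta> n) \<noteq> 0" for n
    using assms(1) [of n] by simp
  have T_power: "T (\<lambda>z. z ^ n) = (\<lambda>z. \<Upsilon> z * (\<nu> * z + d) ^ n)" for n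
    by (simp add: T_def weighted_comp_def assms(4))
  \<comment> \<open>Row 0 of the matrix: \<open>T\<close> maps the constant 1 to
    \<open>\<Upsilon>\<close>, and the coefficient of index 0 of
    \<open>T (\<lambda>z. z ^ n)\<close> is its value \<open>\<Upsilon> 0 * d ^ n\<close> at
    0.\<close>
  have coeff: "taylor_coeff \<Upsilon> n * (of_real (\<zeta> n))\<^sup>2 = cnj (\<Upsilon> 0) * cnj d ^ n * (of_real (\<zeta> 0))\<^sup>2" for n
    using self_adjoint_power_coeff [OF sa, of 0 n]
    unfolding T_power by (simp add: taylor_coeff_def)
  have real0: "cnj (\<Upsilon> 0) = \<Upsilon> 0"
    using coeff [of 0] \<zeta>0 by (simp add: taylor_coeff_def)
  define \<alpha> where "\<alpha> = (complex_of_real (\<zeta> 0))\<^sup>2 * cnj (\<Upsilon> 0)"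
  have "\<Upsilon> 0 \<in> \<real>"
    using real0 by (simp add: Reals_cnj_iff)
  then have \<alpha>_real: "\<alpha> \<in> \<real>"
    by (simp add: \<alpha>_def real0)
  have coeff': "taylor_coeff \<Upsilon> n = \<alpha> * (1 / (of_real (\<zeta> n))\<^sup>2 * cnj d ^ n)" for n
    using coeff [of n] \<zeta>0 [of n] by (simp add: \<alpha>_def field_simps)
  have kernel: "\<Upsilon> z = \<alpha> * HE_kernel \<zeta> (\<Phi> 0) z" for z
  proof (cases "\<alpha> = 0")
    case True
    then show ?thesis
      using taylor_coeff_sums [OF assms(5), of z] by (simp add: coeff' sums_iff)
  next
    case False
    have "(\<lambda>n. \<alpha> * (1 / (of_real (\<zeta> n))\<^sup>2 * cnj d ^ n * z ^ n)) sums \<Upsilon> z"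
      using taylor_coeff_sums [OF assms(5), of z] by (simp add: coeff' mult.assoc)
    from sums_divide [OF this, of \<alpha>]
    have "(\<lambda>n. 1 / (of_real (\<zeta> n))\<^sup>2 * cnj d ^ n * z ^ n) sums (\<Upsilon> z / \<alpha>)"
      using False by simp
    then have "HE_kernel \<zeta> (\<Phi> 0) z = \<Upsilon> z / \<alpha>"
      by (simp add: HE_kernel_def assms(4) sums_iff)
    then show ?thesis
      using False by simp
  qed
  have zero: "\<Upsilon> z = 0" if "\<Upsilon> 0 = 0" for z
    using kernel [of z] that by (simp add: \<alpha>_def)
  have "\<nu> \<in> \<real>" if "\<Upsilon> 0 \<noteq> 0"
  proof -
    have "(\<Upsilon> has_field_derivative taylor_coeff \<Upsilon> 1) (at 0)"
      using holomorphic_derivI [OF assms(5), of 0] by (simp add: taylor_coeff_def)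
    \<comment> \<open>The product rule gives the coefficient of \<open>z\<close> in the image of the
      monomial \<open>z\<close>, as the derivative at 0.\<close>
    then have "((\<lambda>z. \<Upsilon> z * (\<nu> * z + d)) has_field_derivative (\<Upsilon> 0 * \<nu> + taylor_coeff \<Upsilon> 1 * d)) (at 0)"
      by (auto intro!: derivative_eq_intros)
    then have "taylor_coeff (T (\<lambda>z. z ^ 1)) 1 = \<Upsilon> 0 * \<nu> + taylor_coeff \<Upsilon> 1 * d"
      unfolding T_power by (simp add: taylor_coeff_def DERIV_imp_deriv)
    \<comment> \<open>A diagonal entry: both sides carry the same nonzero weight
      \<open>(\<zeta> 1)\<^sup>2\<close>, so the coefficient equals its own conjugate.\<close>
    moreover have "taylor_coeff (T (\<lambda>z. z ^ 1)) 1 \<in> \<real>"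
      using self_adjoint_power_coeff [OF sa, of 1 1] \<zeta>0 [of 1] by (simp add: Reals_cnj_iff)
    moreover have "taylor_coeff \<Upsilon> 1 * d \<in> \<real>"
    proof -
      \<comment> \<open>The kernel formula supplies the factor \<open>cnj d\<close> that turns
        \<open>d\<close> into the squared modulus of \<open>d\<close>.\<close>
      have "taylor_coeff \<Upsilon> 1 * d = \<alpha> * (1 / (of_real (\<zeta> 1))\<^sup>2) * (d * cnj d)"
        by (simp add: coeff')
      also have "\<dots> \<in> \<real>"
        by (rule Reals_mult [OF Reals_mult [OF \<alpha>_real]]) (auto simp: complex_mult_cnj)
      finally show ?thesis .
    qed
    ultimately have "\<Upsilon> 0 * \<nu> \<in> \<real>"
      by (metis Reals_diff add_diff_cancel_right')
    then have "\<Upsilon> 0 * \<nu> / \<Upsilon> 0 \<in> \<real>"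
      using \<open>\<Upsilon> 0 \<in> \<real>\<close> by (rule Reals_divide)
    then show ?thesis
      using that by simp
  qed
  then show ?thesis
    unfolding Let_def \<alpha>_def [symmetric] weighted_comp_def
    by (intro conjI impI allI ballI \<alpha>_real kernel) (auto dest: zero)
qed

end
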